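(* For all integers $m\ge 1$ and $n \ge 1$, $$\sum_{k=1}^n P_{2k}^{2m+1} = \sum_{i=0}^m P_{2n+1}^{2i+1} \sum_{j=0}^{m-i} \frac{ (-1)^{m+i}\, 2^{3(i-m)}\, (2m-2j+1) }{Q_{2m+1-2j}\, (2i+1) } \binom{2m+1}{j} \binom{m-j+i}{2i} + \sum_{j=0}^m \frac{ (-1)^{j+1}\, P_{2m+1-2j} }{ 2^{3m}\, Q_{2m+1-2j} } \binom{2m+1}{j},$$ where $(P_n)_{n\ge 0}$ is the Pell sequence and $(Q_n)_{n\ge 0}$ is the Pell-Lucas sequence.
   Context: The Pell sequence $(P_n)_{n\ge 0}$ is defined by $P_0=0$, $P_1=1$ and $P_{n+2}=2P_{n+1}+P_n$ for $n\ge 0$. The Pell-Lucas sequence $(Q_n)_{n\ge 0}$ is defined by $Q_0=2$, $Q_1=2$ and $Q_{n+2}=2Q_{n+1}+Q_n$ for $n\ge 0$. The identity is between rational numbers. *)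

theory Defs
  imports Complex_Main
begin

fun pell :: "nat \<Rightarrow> nat" where
  "pell 0 = 0"
| "pell (Suc 0) = 1"
| "pell (Suc (Suc n)) = 2 * pell (Suc n) + pell n"

fun pell_lucas :: "nat \<Rightarrow> nat" where
  "pell_lucas 0 = 2"
| "pell_lucas (Suc 0) = 2"
| "pell_lucas (Suc (Suc n)) = 2 * pell_lucas (Suc n) + pell_lucas n"

end

theory Submission
  imports Defs
begin

text \<open>
  The identity comes from rewriting a power of \<open>P\<^bsub>2k\<^esub>\<close> as a combination of single Pell numbers,
  summing those by telescoping, and rewriting the result as powers of \<open>P\<^bsub>2n+1\<^esub>\<close>.
  Let \<open>\<alpha> = 1 + \<surd>2\<close> and \<open>\<beta> = 1 - \<surd>2\<close>, so that \<open>\<alpha> \<beta> = -1\<close>, and write \<open>r = 2m + 1 - 2j\<close>,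
  which is always odd.

  Since \<open>\<alpha>\<^sup>2\<^sup>k \<beta>\<^sup>2\<^sup>k = 1\<close>, the binomial theorem applied to Binet's formula, with the terms \<open>j\<close> and
  \<open>2m + 1 - j\<close> paired, expresses \<open>8\<^sup>m P\<^bsub>2k\<^esub>\<^sup>2\<^sup>m\<^sup>+\<^sup>1\<close> as the sum over \<open>j \<le> m\<close> of
  \<open>(-1)\<^sup>j (2m+1 choose j) P\<^bsub>2kr\<^esub>\<close> (lemma \<open>pell_even_power\<close>). This is the Pell version of the
  expansion of an odd power of \<open>sinh\<close> into \<open>sinh\<close> of multiples.

  For odd \<open>r\<close> the number \<open>Q\<^bsub>r\<^esub> P\<^bsub>2kr\<^esub>\<close> is the difference of \<open>P\<^bsub>(2k+1)r\<^esub>\<close> and \<open>P\<^bsub>(2k-1)r\<^esub>\<close>, so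
  the sum over \<open>k\<close> telescopes to \<open>(P\<^bsub>(2n+1)r\<^esub> - P\<^bsub>r\<^esub>) / Q\<^bsub>r\<^esub>\<close> (lemma \<open>pell_sum_telescope\<close>). The part
  with \<open>P\<^bsub>r\<^esub>\<close> is the second sum of the theorem.

  Finally, for odd \<open>N\<close> one has \<open>\<beta>\<^sup>N = - 1 / \<alpha>\<^sup>N\<close>, so \<open>\<surd>2 P\<^bsub>N\<^esub>\<close> is the hyperbolic cosine of
  \<open>N ln \<alpha>\<close>. Hence \<open>P\<^bsub>Nr\<^esub>\<close> is a rescaled Chebyshev polynomial of degree \<open>r\<close> in \<open>P\<^bsub>N\<^esub>\<close> (lemma
  \<open>pell_odd_multiple\<close>). Taking \<open>N = 2n + 1\<close> and exchanging the sums over \<open>i\<close> and \<open>j\<close> gives the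
  first sum.
\<close>

section \<open>Binet formulas\<close>

lemma pell_binet: "real (pell n) * (2 * sqrt 2) = (1 + sqrt 2) ^ n - (1 - sqrt 2) ^ n"
proof (induction n rule: pell.induct)
  case (3 n)
  have s: "sqrt 2 * sqrt 2 = (2::real)" by simp
  have roots: "(1 + sqrt 2) ^ Suc (Suc n) = 2 * (1 + sqrt 2) ^ Suc n + (1 + sqrt 2) ^ n"
       "(1 - sqrt 2) ^ Suc (Suc n) = 2 * (1 - sqrt 2) ^ Suc n + (1 - sqrt 2) ^ n"
    using s by (simp_all add: algebra_simps)
  have "real (pell (Suc (Suc n))) * (2 * sqrt 2)
      = 2 * (real (pell (Suc n)) * (2 * sqrt 2)) + real (pell n) * (2 * sqrt 2)"
    by (simp add: algebra_simps)
  then show ?case unfolding 3 roots by (simp add: algebra_simps)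
qed auto

lemma pell_lucas_binet: "real (pell_lucas n) = (1 + sqrt 2) ^ n + (1 - sqrt 2) ^ n"
proof (induction n rule: pell_lucas.induct)
  case (3 n)
  have s: "sqrt 2 * sqrt 2 = (2::real)" by simp
  have roots: "(1 + sqrt 2) ^ Suc (Suc n) = 2 * (1 + sqrt 2) ^ Suc n + (1 + sqrt 2) ^ n"
       "(1 - sqrt 2) ^ Suc (Suc n) = 2 * (1 - sqrt 2) ^ Suc n + (1 - sqrt 2) ^ n"
    using s by (simp_all add: algebra_simps)
  have "real (pell_lucas (Suc (Suc n))) = 2 * real (pell_lucas (Suc n)) + real (pell_lucas n)"
    by simp
  then show ?case unfolding 3 roots by (simp add: algebra_simps)
qed auto

lemma binet_roots_power_mult: "(1 + sqrt 2) ^ n * (1 - sqrt 2) ^ n = ((- 1) ^ n :: real)"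
proof -
  have "(1 + sqrt 2) * (1 - sqrt 2) = (-1::real)" by (simp add: algebra_simps)
  then show ?thesis by (metis power_mult_distrib)
qed

lemma pell_lucas_pos: "pell_lucas n > 0"
  by (induction n rule: pell_lucas.induct) auto

section \<open>Odd powers of Pell numbers of even index\<close>

text \<open>
  In the binomial expansion the terms \<open>j\<close> and \<open>2m + 1 - j\<close> have the same binomial coefficient and
  opposite signs; cancelling \<open>x y = 1\<close> leaves a pure power of \<open>x\<close> in one and of \<open>y\<close> in the other.
\<close>

lemma diff_odd_power_inverse_pair:
  fixes x y :: "'a::comm_ring_1"
  assumes xy: "x * y = 1"
  shows "(x - y) ^ (2 * m + 1) =
    (\<Sum>j=0..m. (- 1) ^ j * of_nat ((2 * m + 1) choose j) *
       (x ^ (2 * m + 1 - 2 * j) - y ^ (2 * m + 1 - 2 * j)))"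
proof -
  define f where "f j = of_nat ((2 * m + 1) choose j) * (- y) ^ j * x ^ (2 * m + 1 - j)" for j
  have cancel: "u ^ j * v ^ (j + d) = v ^ d" if "u * v = 1" for u v :: 'a and j d
    using that by (metis mult.assoc mult_1 power_add power_mult_distrib power_one)
  have low: "f j = (- 1) ^ j * of_nat ((2 * m + 1) choose j) * x ^ (2 * m + 1 - 2 * j)"
    if "j \<le> m" for j
  proof -
    have "2 * m + 1 - j = j + (2 * m + 1 - 2 * j)" using that by simp
    then have "y ^ j * x ^ (2 * m + 1 - j) = x ^ (2 * m + 1 - 2 * j)"
      using cancel[of y x] xy by (metis mult.commute)
    then show ?thesis unfolding f_def by (simp add: power_minus[of y] mult.assoc mult.left_commute)
  qed
  have high: "f (2 * m + 1 - j)
      = - ((- 1) ^ j * of_nat ((2 * m + 1) choose j) * y ^ (2 * m + 1 - 2 * j))"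
    if "j \<le> m" for j
  proof -
    have e: "2 * m + 1 - j = j + (2 * m + 1 - 2 * j)" using that by simp
    have prod: "x ^ j * y ^ (2 * m + 1 - j) = y ^ (2 * m + 1 - 2 * j)"
      unfolding e using cancel[OF xy] by simp
    have sign: "(- 1 :: 'a) ^ (2 * m + 1 - j) = - ((- 1) ^ j)"
      using that by (auto simp: minus_one_power_iff)
    have symm: "(2 * m + 1) choose (2 * m + 1 - j) = (2 * m + 1) choose j"
      using that by (intro binomial_symmetric[symmetric]) simp
    have "2 * m + 1 - (2 * m + 1 - j) = j" using that by simp
    then have "f (2 * m + 1 - j) = (- 1) ^ (2 * m + 1 - j) * of_nat ((2 * m + 1) choose j)
        * (x ^ j * y ^ (2 * m + 1 - j))"
      unfolding f_def power_minus[of y] symm by (simp only: mult_ac)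
    then show ?thesis unfolding prod sign by simp
  qed
  have "(x - y) ^ (2 * m + 1) = (\<Sum>j\<le>2 * m + 1. f j)"
    using binomial_ring[of "- y" x "2 * m + 1"] by (simp add: f_def)
  also have "{..2 * m + 1} = {0..m} \<union> {m + 1..2 * m + 1}" by auto
  also have "(\<Sum>j\<in>\<dots>. f j) = (\<Sum>j=0..m. f j) + (\<Sum>j=m + 1..2 * m + 1. f j)"
    by (rule sum.union_disjoint) auto
  also have "(\<Sum>j=m + 1..2 * m + 1. f j) = (\<Sum>j=0..m. f (2 * m + 1 - j))"
    by (rule sum.reindex_bij_witness[of _ "\<lambda>j. 2 * m + 1 - j" "\<lambda>j. 2 * m + 1 - j"]) auto
  also have "(\<Sum>j=0..m. f j) + \<dots> = (\<Sum>j=0..m. f j + f (2 * m + 1 - j))"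
    by (simp add: sum.distrib)
  also have "\<dots> = (\<Sum>j=0..m. (- 1) ^ j * of_nat ((2 * m + 1) choose j) *
       (x ^ (2 * m + 1 - 2 * j) - y ^ (2 * m + 1 - 2 * j)))"
    by (intro sum.cong refl, subst low, simp, subst high) (simp_all add: algebra_simps)
  finally show ?thesis .
qed

text \<open>
  Binet's formula turns the previous lemma, with \<open>x = \<alpha>\<^sup>2\<^sup>k\<close> and \<open>y = \<beta>\<^sup>2\<^sup>k\<close>, into a statement about
  Pell numbers; the factor \<open>8\<^sup>m\<close> is \<open>(2 \<surd>2)\<^sup>2\<^sup>m\<close>. Phrased over the integers, it can be
  read in the rational numbers.
\<close>

lemma pell_even_power:
  "8 ^ m * int (pell (2 * k)) ^ (2 * m + 1) =
    (\<Sum>j=0..m. (- 1) ^ j * int ((2 * m + 1) choose j) * int (pell (2 * k * (2 * m + 1 - 2 * j))))"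
proof -
  let ?x = "(1 + sqrt 2) ^ (2 * k)" and ?y = "(1 - sqrt 2) ^ (2 * k) :: real"
  let ?c = "2 * sqrt 2 :: real"
  have c8: "?c ^ (2 * m + 1) = 8 ^ m * ?c"
    by (simp add: power_mult power_mult_distrib)
  have "(8 ^ m * real (pell (2 * k)) ^ (2 * m + 1)) * ?c
      = real (pell (2 * k)) ^ (2 * m + 1) * ?c ^ (2 * m + 1)"
    unfolding c8 by (simp only: mult_ac)
  also have "\<dots> = (?x - ?y) ^ (2 * m + 1)"
    by (simp only: power_mult_distrib[symmetric] pell_binet)
  also have "\<dots> = (\<Sum>j=0..m. (- 1) ^ j * real ((2 * m + 1) choose j) *
       (?x ^ (2 * m + 1 - 2 * j) - ?y ^ (2 * m + 1 - 2 * j)))"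
    by (rule diff_odd_power_inverse_pair) (simp add: binet_roots_power_mult)
  also have "\<dots> = (\<Sum>j=0..m. (- 1) ^ j * real ((2 * m + 1) choose j) *
       real (pell (2 * k * (2 * m + 1 - 2 * j)))) * ?c"
    by (simp only: power_mult[symmetric] pell_binet[symmetric] sum_distrib_right mult.assoc)
  finally have "real_of_int (8 ^ m * int (pell (2 * k)) ^ (2 * m + 1)) =
      real_of_int (\<Sum>j=0..m. (- 1) ^ j * int ((2 * m + 1) choose j) *
        int (pell (2 * k * (2 * m + 1 - 2 * j))))"
    by simp
  then show ?thesis by (simp only: of_int_eq_iff)
qed

section \<open>Telescoping\<close>

lemma pell_lucas_mult_pell:
  assumes "odd r"
  shows "pell_lucas r * pell (2 * (k + 1) * r) + pell ((2 * k + 1) * r) = pell ((2 * k + 3) * r)"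
proof -
  define a b :: real where "a = (1 + sqrt 2) ^ r" and "b = (1 - sqrt 2) ^ r"
  have ab: "a * b = - 1"
    unfolding a_def b_def binet_roots_power_mult using assms by simp
  have P: "real (pell (q * r)) * (2 * sqrt 2) = a ^ q - b ^ q" for q
    unfolding pell_binet a_def b_def by (simp add: power_mult[symmetric] mult.commute)
  have Q: "real (pell_lucas r) = a + b"
    unfolding pell_lucas_binet a_def b_def ..
  have e: "2 * (k + 1) = Suc (2 * k + 1)" "2 * k + 3 = Suc (Suc (2 * k + 1))" by simp_all
  have "(pell_lucas r * pell (2 * (k + 1) * r) + pell ((2 * k + 1) * r)) * (2 * sqrt 2)
      = real (pell_lucas r) * (real (pell (2 * (k + 1) * r)) * (2 * sqrt 2))
        + real (pell ((2 * k + 1) * r)) * (2 * sqrt 2)"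
    by (simp add: algebra_simps)
  also have "\<dots> = (a + b) * (a ^ (2 * (k + 1)) - b ^ (2 * (k + 1))) + (a ^ (2 * k + 1) - b ^ (2 * k + 1))"
    unfolding P Q ..
  also have "\<dots> = a ^ (2 * k + 3) - b ^ (2 * k + 3) + (a * b + 1) * (a ^ (2 * k + 1) - b ^ (2 * k + 1))"
    unfolding e power_Suc by (simp add: algebra_simps)
  also have "\<dots> = pell ((2 * k + 3) * r) * (2 * sqrt 2)"
    unfolding P ab by simp
  finally have "real (pell_lucas r * pell (2 * (k + 1) * r) + pell ((2 * k + 1) * r))
      = real (pell ((2 * k + 3) * r))"
    by simp
  then show ?thesis by (simp only: of_nat_eq_iff)
qed

lemma pell_sum_telescope:
  assumes "odd r"
  shows "pell_lucas r * (\<Sum>k=1..n. pell (2 * k * r)) + pell r = pell ((2 * n + 1) * r)"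
proof (induction n)
  case (Suc n)
  have "2 * Suc n + 1 = 2 * n + 3" by simp
  then show ?case
    using Suc pell_lucas_mult_pell[OF assms, of n] by (simp add: algebra_simps)
qed simp

section \<open>Odd multiples of an odd index\<close>

text \<open>
  The absolute values of the coefficients of the Chebyshev polynomial of degree \<open>2s + 1\<close>, up to
  scaling. In this form, unlike in the quotient form of the next lemma, they are visibly integers
  and their recurrence is a matter of Pascal's rule alone.
\<close>

definition chebyshev_coeff :: "nat \<Rightarrow> nat \<Rightarrow> nat" where
  "chebyshev_coeff s i = ((s + i) choose (2 * i)) + 2 * ((s + i) choose (2 * i + 1))"

lemma chebyshev_coeff_quotient:
  assumes "i \<le> s"
  shows "(of_nat (chebyshev_coeff s i) :: 'a::field_char_0) =
    of_nat (2 * s + 1) / of_nat (2 * i + 1) * of_nat ((s + i) choose (2 * i))"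
proof -
  have "(2 * i + 1) * ((s + i) choose (2 * i + 1)) = (s - i) * ((s + i) choose (2 * i))"
    using binomial_absorb_comp[of "s + i" "2 * i"] binomial_absorption[of "2 * i" "s + i"] assms
    by simp
  then have "(2 * i + 1) * chebyshev_coeff s i
      = ((2 * i + 1) + 2 * (s - i)) * ((s + i) choose (2 * i))"
    unfolding chebyshev_coeff_def distrib_left distrib_right mult.left_commute[of _ 2] by simp
  also have "(2 * i + 1) + 2 * (s - i) = 2 * s + 1" using assms by simp
  finally have "(2 * i + 1) * chebyshev_coeff s i = (2 * s + 1) * ((s + i) choose (2 * i))" .
  then have "(of_nat (2 * i + 1) :: 'a) * of_nat (chebyshev_coeff s i) =
      of_nat (2 * s + 1) * of_nat ((s + i) choose (2 * i))"
    by (metis of_nat_mult)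
  moreover have "(of_nat (2 * i + 1) :: 'a) \<noteq> 0" by (simp only: of_nat_eq_0_iff)
  ultimately show ?thesis by (simp add: field_simps del: of_nat_add of_nat_mult)
qed

lemma chebyshev_coeff_eq_0: "s < i \<Longrightarrow> chebyshev_coeff s i = 0"
  by (simp add: chebyshev_coeff_def)

lemma chebyshev_coeff_Suc_Suc:
  "chebyshev_coeff (Suc (Suc s)) (Suc i) + chebyshev_coeff s (Suc i) =
    chebyshev_coeff (Suc s) i + 2 * chebyshev_coeff (Suc s) (Suc i)"
  by (simp add: chebyshev_coeff_def)

text \<open>
  With \<open>a = \<alpha>\<^sup>N\<close> and \<open>b = \<beta>\<^sup>N\<close>, multiplication by \<open>8 P\<^bsub>N\<^esub>\<^sup>2 - 2 = (a - b)\<^sup>2 - 2 = a\<^sup>2 + b\<^sup>2\<close>, where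
  \<open>a\<^sup>2 b\<^sup>2 = 1\<close>, shifts the multiple \<open>r\<close> of \<open>N\<close> by two in both directions.
\<close>

lemma pell_odd_multiple_rec:
  assumes "odd N"
  shows "int (pell (N * (r + 4))) =
    (8 * int (pell N) ^ 2 - 2) * int (pell (N * (r + 2))) - int (pell (N * r))"
proof -
  define a b :: real where "a = (1 + sqrt 2) ^ N" and "b = (1 - sqrt 2) ^ N"
  have ab: "a * b = - 1"
    unfolding a_def b_def binet_roots_power_mult using assms by simp
  have P: "real (pell (N * q)) * (2 * sqrt 2) = a ^ q - b ^ q" for q
    unfolding pell_binet a_def b_def by (simp add: power_mult)
  have "8 * real (pell N) ^ 2 = (real (pell N) * (2 * sqrt 2)) ^ 2"
    by (simp add: power_mult_distrib)
  also have "\<dots> = (a - b) ^ 2"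
    using P[of 1] by simp
  finally have sq: "8 * real (pell N) ^ 2 - 2 = a ^ 2 + b ^ 2"
    using ab by (simp add: power2_eq_square algebra_simps)
  have "(8 * real (pell N) ^ 2 - 2) * (real (pell (N * (r + 2))) * (2 * sqrt 2))
        - real (pell (N * r)) * (2 * sqrt 2)
      = (a ^ 2 + b ^ 2) * (a ^ (r + 2) - b ^ (r + 2)) - (a ^ r - b ^ r)"
    unfolding sq P ..
  also have "\<dots> = a ^ (r + 4) - b ^ (r + 4) + ((a * b) ^ 2 - 1) * (a ^ r - b ^ r)"
    by (simp add: power_add algebra_simps power2_eq_square power4_eq_xxxx)
  also have "\<dots> = real (pell (N * (r + 4))) * (2 * sqrt 2)"
    unfolding P ab by simp
  finally have "real (pell (N * (r + 4))) * (2 * sqrt 2)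
      = ((8 * real (pell N) ^ 2 - 2) * real (pell (N * (r + 2))) - real (pell (N * r))) * (2 * sqrt 2)"
    by (simp only: left_diff_distrib mult.assoc)
  then have "real_of_int (int (pell (N * (r + 4)))) = real_of_int
      ((8 * int (pell N) ^ 2 - 2) * int (pell (N * (r + 2))) - int (pell (N * r)))"
    by simp
  then show ?thesis by (simp only: of_int_eq_iff)
qed

lemma pell_triple:
  assumes "odd N"
  shows "int (pell (N * 3)) = 8 * int (pell N) ^ 3 - 3 * int (pell N)"
proof -
  define a b :: real where "a = (1 + sqrt 2) ^ N" and "b = (1 - sqrt 2) ^ N"
  have ab: "a * b = - 1"
    unfolding a_def b_def binet_roots_power_mult using assms by simp
  have P: "real (pell (N * q)) * (2 * sqrt 2) = a ^ q - b ^ q" for q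
    unfolding pell_binet a_def b_def by (simp add: power_mult)
  have P1: "real (pell N) * (2 * sqrt 2) = a - b"
    using P[of 1] by simp
  have c3: "(2 * sqrt 2) ^ 3 = 8 * (2 * sqrt 2 :: real)"
    by (simp add: power3_eq_cube)
  have "(8 * real (pell N) ^ 3 - 3 * real (pell N)) * (2 * sqrt 2)
      = real (pell N) ^ 3 * (2 * sqrt 2) ^ 3 - 3 * (real (pell N) * (2 * sqrt 2))"
    unfolding c3 by (simp add: algebra_simps)
  also have "\<dots> = (a - b) ^ 3 - 3 * (a - b)"
    unfolding power_mult_distrib[symmetric] P1 ..
  also have "\<dots> = a ^ 3 - b ^ 3 - 3 * (a * b + 1) * (a - b)"
    by (simp add: power3_eq_cube algebra_simps)
  also have "\<dots> = real (pell (N * 3)) * (2 * sqrt 2)"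
    unfolding P ab by simp
  finally have "real_of_int (int (pell (N * 3)))
      = real_of_int (8 * int (pell N) ^ 3 - 3 * int (pell N))"
    by simp
  then show ?thesis by (simp only: of_int_eq_iff)
qed

text \<open>
  Both sides satisfy the recurrence of \<open>pell_odd_multiple_rec\<close> in \<open>s\<close>. The bound \<open>M\<close> of
  the sum is independent of \<open>s\<close>, the coefficients beyond \<open>i = s\<close> being zero: this keeps the three sums
  of the recurrence over one index set, and it makes the later exchange of sums one over a rectangle.
\<close>

lemma pell_odd_multiple:
  assumes N: "odd N" and "s \<le> M"
  shows "int (pell (N * (2 * s + 1))) =
    (\<Sum>i\<le>M. (- 1) ^ (s + i) * 8 ^ i * int (chebyshev_coeff s i) * int (pell N) ^ (2 * i + 1))"
  using \<open>s \<le> M\<close>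
proof (induction s rule: induct_nat_012)
  case 0
  have "(\<Sum>i\<le>M. (- 1) ^ (0 + i) * 8 ^ i * int (chebyshev_coeff 0 i) * int (pell N) ^ (2 * i + 1))
      = (\<Sum>i\<in>{0}. (- 1) ^ (0 + i) * 8 ^ i * int (chebyshev_coeff 0 i) * int (pell N) ^ (2 * i + 1))"
    by (rule sum.mono_neutral_right) (auto simp: chebyshev_coeff_eq_0)
  then show ?case by (simp add: chebyshev_coeff_def)
next
  case 1
  have "(\<Sum>i\<le>M. (- 1) ^ (Suc 0 + i) * 8 ^ i * int (chebyshev_coeff (Suc 0) i) * int (pell N) ^ (2 * i + 1))
      = (\<Sum>i\<in>{0, 1}. (- 1) ^ (Suc 0 + i) * 8 ^ i * int (chebyshev_coeff (Suc 0) i) * int (pell N) ^ (2 * i + 1))"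
    using 1 by (intro sum.mono_neutral_right) (auto simp: chebyshev_coeff_eq_0)
  also have "\<dots> = 8 * int (pell N) ^ 3 - 3 * int (pell N)"
    by (simp add: chebyshev_coeff_def choose_two binomial_eq_0 power2_eq_square power3_eq_cube)
  finally show ?case using pell_triple[OF N] by (simp add: numeral_3_eq_3)
next
  case (ge2 s)
  define x where "x = int (pell N)"
  define t where "t s i = (- 1) ^ (s + i) * 8 ^ i * int (chebyshev_coeff s i) * x ^ (2 * i + 1)" for s i
  obtain L where M: "M = Suc L" and L: "Suc s \<le> L"
    using ge2.prems by (cases M) auto
  have step0: "t (Suc (Suc s)) 0 = - 2 * t (Suc s) 0 - t s 0"
    by (simp add: t_def chebyshev_coeff_def algebra_simps)
  have step: "t (Suc (Suc s)) (Suc i) = 8 * x\<^sup>2 * t (Suc s) i - 2 * t (Suc s) (Suc i) - t s (Suc i)" for i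
  proof -
    have c: "int (chebyshev_coeff (Suc (Suc s)) (Suc i)) = int (chebyshev_coeff (Suc s) i)
        + 2 * int (chebyshev_coeff (Suc s) (Suc i)) - int (chebyshev_coeff s (Suc i))"
      using chebyshev_coeff_Suc_Suc[of s i] by linarith
    show ?thesis unfolding t_def c by (simp add: algebra_simps power2_eq_square)
  qed
  \<comment> \<open>Multiplication by \<open>x\<^sup>2\<close> moves every index up by one; nothing leaves the range.\<close>
  have top: "t (Suc s) M = 0"
    using L by (simp add: t_def M chebyshev_coeff_eq_0)
  have rec: "(\<Sum>i\<le>M. t (Suc (Suc s)) i)
      = (8 * x\<^sup>2 - 2) * (\<Sum>i\<le>M. t (Suc s) i) - (\<Sum>i\<le>M. t s i)"
  proof -
    have shift: "(\<Sum>i\<le>M. t q i) = t q 0 + (\<Sum>i\<le>L. t q (Suc i))" for q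
      unfolding M by (rule sum.atMost_Suc_shift)
    have "(\<Sum>i\<le>M. t (Suc (Suc s)) i)
        = 8 * x\<^sup>2 * (\<Sum>i\<le>L. t (Suc s) i) - 2 * (\<Sum>i\<le>M. t (Suc s) i) - (\<Sum>i\<le>M. t s i)"
      unfolding shift step0 step
      by (simp add: sum.distrib sum_subtractf sum_distrib_left algebra_simps)
    also have "(\<Sum>i\<le>L. t (Suc s) i) = (\<Sum>i\<le>M. t (Suc s) i)"
      using top by (simp add: M)
    finally show ?thesis by (simp add: algebra_simps)
  qed
  have "int (pell (N * (2 * s + 1))) = (\<Sum>i\<le>M. t s i)"
    "int (pell (N * (2 * Suc s + 1))) = (\<Sum>i\<le>M. t (Suc s) i)"
    using ge2 unfolding t_def x_def by simp_all
  moreover have "(2 * s + 1) + 2 = 2 * Suc s + 1" "(2 * s + 1) + 4 = 2 * Suc (Suc s) + 1" by simp_all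
  ultimately have "int (pell (N * (2 * Suc (Suc s) + 1))) = (\<Sum>i\<le>M. t (Suc (Suc s)) i)"
    using pell_odd_multiple_rec[OF N, of "2 * s + 1"] unfolding rec x_def by (simp only:)
  then show ?case unfolding t_def x_def .
qed

section \<open>The power sum\<close>

lemma two_powi_triple_diff: "(2 :: 'a::field_char_0) powi (3 * (int i - int m)) = 8 ^ i / 8 ^ m"
proof -
  have "(2 :: 'a) powi (3 * (int i - int m)) = (2 powi 3) powi (int i - int m)"
    by (rule power_int_mult)
  also have "\<dots> = 8 powi int i / 8 powi int m"
    by (simp add: power_int_diff)
  finally show ?thesis by simp
qed

theorem theorem3:
  fixes m n :: nat
  assumes "m \<ge> 1" and "n \<ge> 1"
  shows "(\<Sum>k=1..n. (of_nat (pell (2 * k)) :: rat) ^ (2 * m + 1)) =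
    (\<Sum>i=0..m. (of_nat (pell (2 * n + 1)) :: rat) ^ (2 * i + 1) *
       (\<Sum>j=0..m - i.
          ((- 1) ^ (m + i) * 2 powi (3 * (int i - int m)) * of_nat (2 * m - 2 * j + 1))
            / (of_nat (pell_lucas (2 * m + 1 - 2 * j)) * of_nat (2 * i + 1))
          * of_nat ((2 * m + 1) choose j) * of_nat ((m - j + i) choose (2 * i))))
    + (\<Sum>j=0..m.
          ((- 1) ^ (j + 1) * of_nat (pell (2 * m + 1 - 2 * j)))
            / (2 ^ (3 * m) * of_nat (pell_lucas (2 * m + 1 - 2 * j)))
          * of_nat ((2 * m + 1) choose j))"
proof -
  define P Q :: "nat \<Rightarrow> rat" where "P q = of_nat (pell q)" and "Q q = of_nat (pell_lucas q)" for q
  define r where "r j = 2 * m + 1 - 2 * j" for j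
  define w :: "nat \<Rightarrow> rat" where "w j = (- 1) ^ j * of_nat ((2 * m + 1) choose j) / 8 ^ m" for j
  define c :: "nat \<Rightarrow> nat \<Rightarrow> rat" where
    "c i j = w j * ((- 1) ^ (m - j + i) * 8 ^ i * of_nat (chebyshev_coeff (m - j) i)) / Q (r j)" for i j
  have Q0: "Q q \<noteq> 0" for q
    using pell_lucas_pos[of q] by (simp add: Q_def)
  have r: "r j = 2 * (m - j) + 1" if "j \<le> m" for j
    using that by (simp add: r_def)
  have power: "P (2 * k) ^ (2 * m + 1) = (\<Sum>j=0..m. w j * P (2 * k * r j))" for k
  proof -
    have "8 ^ m * P (2 * k) ^ (2 * m + 1) =
        (\<Sum>j=0..m. (- 1) ^ j * of_nat ((2 * m + 1) choose j) * P (2 * k * r j))"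
      using arg_cong[OF pell_even_power[of m k], of "of_int :: int \<Rightarrow> rat"]
      by (simp add: P_def r_def)
    then have "P (2 * k) ^ (2 * m + 1) =
        (\<Sum>j=0..m. (- 1) ^ j * of_nat ((2 * m + 1) choose j) * P (2 * k * r j)) / 8 ^ m"
      by (metis nonzero_mult_div_cancel_left power_not_zero zero_neq_numeral)
    then show ?thesis by (simp add: w_def sum_divide_distrib)
  qed
  have telescope: "(\<Sum>k=1..n. P (2 * k * r j)) = (P ((2 * n + 1) * r j) - P (r j)) / Q (r j)"
    if "j \<le> m" for j
  proof -
    have "odd (r j)" using r[OF that] by simp
    have "Q (r j) * (\<Sum>k=1..n. P (2 * k * r j)) + P (r j) = P ((2 * n + 1) * r j)"
      using arg_cong[OF pell_sum_telescope[OF \<open>odd (r j)\<close>, of n], of "of_nat :: nat \<Rightarrow> rat"]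
      by (simp only: P_def Q_def of_nat_add of_nat_mult of_nat_sum)
    then show ?thesis using Q0[of "r j"] by (simp add: field_simps)
  qed
  have expand: "w j * P ((2 * n + 1) * r j) / Q (r j) = (\<Sum>i=0..m. P (2 * n + 1) ^ (2 * i + 1) * c i j)"
    if "j \<le> m" for j
  proof -
    have "P ((2 * n + 1) * r j) = (\<Sum>i\<le>m. (- 1) ^ (m - j + i) * 8 ^ i *
        of_nat (chebyshev_coeff (m - j) i) * P (2 * n + 1) ^ (2 * i + 1))"
      using arg_cong[OF pell_odd_multiple[of "2 * n + 1" "m - j" m], of "of_int :: int \<Rightarrow> rat"]
      unfolding r[OF that] P_def by (simp del: of_nat_Suc of_nat_add)
    then show ?thesis
      by (simp add: c_def sum_distrib_left sum_divide_distrib atLeast0AtMost mult_ac)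
  qed
  have coeff: "c i j = ((- 1) ^ (m + i) * 2 powi (3 * (int i - int m)) * of_nat (2 * m - 2 * j + 1))
            / (Q (r j) * of_nat (2 * i + 1))
          * of_nat ((2 * m + 1) choose j) * of_nat ((m - j + i) choose (2 * i))"
    if "i \<le> m" "j \<le> m - i" for i j
  proof -
    have i: "i \<le> m - j" and e: "2 * m - 2 * j + 1 = 2 * (m - j) + 1" using that by auto
    have "m + i = j + (m - j + i)" using that by simp
    then have sign: "(- 1 :: rat) ^ (m + i) = (- 1) ^ j * (- 1) ^ (m - j + i)"
      by (metis power_add)
    show ?thesis
      unfolding c_def w_def chebyshev_coeff_quotient[OF i] two_powi_triple_diff sign e
      by (simp only: times_divide_eq_left times_divide_eq_right divide_divide_eq_left mult_ac)
  qed
  have "(\<Sum>k=1..n. P (2 * k) ^ (2 * m + 1)) = (\<Sum>j=0..m. w j * (\<Sum>k=1..n. P (2 * k * r j)))"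
    unfolding power sum_distrib_left by (rule sum.swap)
  also have "\<dots> = (\<Sum>j=0..m. w j * P ((2 * n + 1) * r j) / Q (r j) + - w j * P (r j) / Q (r j))"
    by (intro sum.cong refl, subst telescope) (simp_all add: diff_divide_distrib algebra_simps)
  also have "\<dots> = (\<Sum>j=0..m. \<Sum>i=0..m. P (2 * n + 1) ^ (2 * i + 1) * c i j)
      + (\<Sum>j=0..m. - w j * P (r j) / Q (r j))"
  proof -
    have "(\<Sum>j=0..m. w j * P ((2 * n + 1) * r j) / Q (r j))
        = (\<Sum>j=0..m. \<Sum>i=0..m. P (2 * n + 1) ^ (2 * i + 1) * c i j)"
      by (intro sum.cong refl expand) simp
    then show ?thesis by (simp only: sum.distrib)
  qed
  also have "(\<Sum>j=0..m. \<Sum>i=0..m. P (2 * n + 1) ^ (2 * i + 1) * c i j)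
      = (\<Sum>i=0..m. P (2 * n + 1) ^ (2 * i + 1) * (\<Sum>j=0..m. c i j))"
    unfolding sum_distrib_left by (rule sum.swap)
  also have "\<dots> = (\<Sum>i=0..m. P (2 * n + 1) ^ (2 * i + 1) * (\<Sum>j=0..m - i. c i j))"
  proof -
    have "(\<Sum>j=0..m. c i j) = (\<Sum>j=0..m - i. c i j)" for i
      by (rule sum.mono_neutral_right) (auto simp: c_def chebyshev_coeff_eq_0)
    then show ?thesis by simp
  qed
  also have "\<dots> = (\<Sum>i=0..m. P (2 * n + 1) ^ (2 * i + 1) * (\<Sum>j=0..m - i.
      ((- 1) ^ (m + i) * 2 powi (3 * (int i - int m)) * of_nat (2 * m - 2 * j + 1))
            / (Q (r j) * of_nat (2 * i + 1))
          * of_nat ((2 * m + 1) choose j) * of_nat ((m - j + i) choose (2 * i))))"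
    by (intro sum.cong refl arg_cong2[where f = "(*)"] coeff) auto
  also have "(\<Sum>j=0..m. - w j * P (r j) / Q (r j)) = (\<Sum>j=0..m.
      ((- 1) ^ (j + 1) * P (r j)) / (2 ^ (3 * m) * Q (r j)) * of_nat ((2 * m + 1) choose j))"
  proof -
    have "(8 :: rat) ^ m = 2 ^ (3 * m)" by (simp add: power_mult)
    then show ?thesis unfolding w_def by (simp add: mult_ac)
  qed
  finally show ?thesis unfolding P_def Q_def r_def .
qed

end
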